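(* Let $p\ge1$, $\alpha\in(0,1)$, $\epsilon>0$ and $n^*\geq 1$. For each $n\ge n^*$ let $\Lambda_n$ be the sample covariance matrix of $Y_1,\dots,Y_n\in\mathbb{R}^p$ and let $\Sigma_n$ be an estimator of the asymptotic covariance matrix $\Sigma$, both positive definite, and let $\widehat{\mathrm{ESS}}=n\left(|\Lambda_n|/|\Sigma_n|\right)^{1/p}$. Then for $n\ge n^*$ the defining inequality of the relative standard deviation fixed-volume sequential stopping rule, $$\mathrm{Vol}(C_\alpha(n))^{1/p}+\epsilon|\Lambda_n|^{1/2p}I(n<n^* )+n^{-1}\le\epsilon|\Lambda_n|^{1/2p},$$ holds if and only if $$\widehat{\mathrm{ESS}}\ \ge\ \left[\left(\frac{2\pi^{p/2}}{p\,\Gamma(p/2)}\right)^{1/p}\left(T^2_{1-\alpha,p,q}\right)^{1/2}+\frac{|\Sigma_n|^{-1/2p}}{n^{1/2}}\right]^2\frac1{\epsilon^2}.$$ Thus the stopping rule, which stops at the first $n$ satisfying the first inequality, is equivalent to terminating the first time $n\ge n^*$ that $\widehat{\mathrm{ESS}}$ is at least this lower bound.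
   Context: $|\cdot|$ denotes the determinant, $I(\cdot)$ the indicator function, and $|A|^{1/2p}$ means $|A|^{1/(2p)}$. With $\theta_n=n^{-1}\sum_{t=1}^nY_t$, the confidence region is $C_\alpha(n)=\{\vartheta\in\mathbb{R}^p:n(\theta_n-\vartheta)^T\Sigma_n^{-1}(\theta_n-\vartheta)<T^2_{1-\alpha,p,q}\}$, whose volume is $$\mathrm{Vol}(C_\alpha(n))=\frac{2\pi^{p/2}}{p\,\Gamma(p/2)}\left(\frac{T^2_{1-\alpha,p,q}}{n}\right)^{p/2}|\Sigma_n|^{1/2}.$$ Here $T^2_{1-\alpha,p,q}>0$ is the $1-\alpha$ quantile of Hotelling's $T$-squared distribution with dimensionality parameter $p$ and degrees of freedom $q$ (which may depend on $n$). $\widehat{\mathrm{ESS}}$ is the estimated multivariate effective sample size. *)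

theory Defs
  imports "HOL-Probability.Probability" "HOL-Library.Extended_Nat"
begin

definition outer :: "real ^ 'p \<Rightarrow> real ^ 'p \<Rightarrow> real ^ 'p ^ 'p" where
  "outer x y = (\<chi> i j. x $ i * y $ j)"

definition positive_definite :: "real ^ 'p ^ 'p \<Rightarrow> bool" where
  "positive_definite A \<longleftrightarrow> transpose A = A \<and> (\<forall>x. x \<noteq> 0 \<longrightarrow> x \<bullet> (A *v x) > 0)"

definition sample_mean :: "(nat \<Rightarrow> real ^ 'p) \<Rightarrow> nat \<Rightarrow> real ^ 'p" where
  "sample_mean Y n = (1 / real n) *\<^sub>R (\<Sum>t=1..n. Y t)"

(* Unbiased normalisation; at n = 1 the value is 0, which is not positive definite. *)
definition sample_cov :: "(nat \<Rightarrow> real ^ 'p) \<Rightarrow> nat \<Rightarrow> real ^ 'p ^ 'p" where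
  "sample_cov Y n =
     (1 / (real n - 1)) *\<^sub>R
       (\<Sum>t=1..n. outer (Y t - sample_mean Y n) (Y t - sample_mean Y n))"

definition std_gaussian :: "(real ^ 'p) measure" where
  "std_gaussian = density lborel (\<lambda>x. ennreal (\<Prod>i\<in>UNIV. std_normal_density (x $ i)))"

(* Wishart distribution with identity scale matrix and q degrees of freedom. *)
definition wishart :: "nat \<Rightarrow> (real ^ 'p ^ 'p) measure" where
  "wishart q =
     distr (\<Pi>\<^sub>M k\<in>{..<q}. std_gaussian) borel (\<lambda>z. \<Sum>k<q. outer (z k) (z k))"

(* Law of q d^T W^{-1} d for independent d ~ N(0, I) and W ~ Wishart(I, q) in dimension
   p = CARD('p). W is almost surely invertible precisely when p \<le> q; for smaller q
   Hotelling's distribution does not exist and the value is meaningless. *)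
definition hotelling :: "'p::finite itself \<Rightarrow> nat \<Rightarrow> real measure" where
  "hotelling _ q =
     distr (std_gaussian \<Otimes>\<^sub>M wishart q) borel
       (\<lambda>(d :: real ^ 'p, W). real q * (d \<bullet> (matrix_inv W *v d)))"

definition quantile :: "real measure \<Rightarrow> real \<Rightarrow> real" where
  "quantile M u = Inf {x. u \<le> cdf M x}"

definition hotelling_quantile :: "'p::finite itself \<Rightarrow> nat \<Rightarrow> real \<Rightarrow> real" where
  "hotelling_quantile P q u = quantile (hotelling P q) u"

(* The estimator enters as the sequence S of its values along the observed path Y. *)
definition confidence_region ::
    "(nat \<Rightarrow> real ^ 'p) \<Rightarrow> (nat \<Rightarrow> real ^ 'p ^ 'p) \<Rightarrow> (nat \<Rightarrow> nat) \<Rightarrow> real \<Rightarrow> nat \<Rightarrow> (real ^ 'p) set" where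
  "confidence_region Y S q \<alpha> n =
     {\<theta>. real n * ((sample_mean Y n - \<theta>) \<bullet> (matrix_inv (S n) *v (sample_mean Y n - \<theta>)))
           < hotelling_quantile TYPE('p) (q n) (1 - \<alpha>)}"

definition region_volume ::
    "(nat \<Rightarrow> real ^ 'p) \<Rightarrow> (nat \<Rightarrow> real ^ 'p ^ 'p) \<Rightarrow> (nat \<Rightarrow> nat) \<Rightarrow> real \<Rightarrow> nat \<Rightarrow> real" where
  "region_volume Y S q \<alpha> n = measure lebesgue (confidence_region Y S q \<alpha> n)"

definition ess :: "(nat \<Rightarrow> real ^ 'p) \<Rightarrow> (nat \<Rightarrow> real ^ 'p ^ 'p) \<Rightarrow> nat \<Rightarrow> real" where
  "ess Y S n = real n * (det (sample_cov Y n) / det (S n)) powr (1 / real CARD('p))"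

definition stopping_inequality ::
    "(nat \<Rightarrow> real ^ 'p) \<Rightarrow> (nat \<Rightarrow> real ^ 'p ^ 'p) \<Rightarrow> (nat \<Rightarrow> nat) \<Rightarrow> real \<Rightarrow> real \<Rightarrow> nat \<Rightarrow> nat \<Rightarrow> bool" where
  "stopping_inequality Y S q \<alpha> \<epsilon> nstar n \<longleftrightarrow>
     region_volume Y S q \<alpha> n powr (1 / real CARD('p))
       + \<epsilon> * det (sample_cov Y n) powr (1 / (2 * real CARD('p))) * (if n < nstar then 1 else 0)
       + 1 / real n
     \<le> \<epsilon> * det (sample_cov Y n) powr (1 / (2 * real CARD('p)))"

definition ess_lower_bound :: "(nat \<Rightarrow> real ^ 'p ^ 'p) \<Rightarrow> (nat \<Rightarrow> nat) \<Rightarrow> real \<Rightarrow> real \<Rightarrow> nat \<Rightarrow> real" where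
  "ess_lower_bound S q \<alpha> \<epsilon> n =
     ((2 * pi powr (real CARD('p) / 2) / (real CARD('p) * Gamma (real CARD('p) / 2)))
          powr (1 / real CARD('p))
        * sqrt (hotelling_quantile TYPE('p) (q n) (1 - \<alpha>))
      + det (S n) powr (- (1 / (2 * real CARD('p)))) / sqrt (real n))\<^sup>2
     * (1 / \<epsilon>\<^sup>2)"

(* First positive sample size satisfying P; \<infinity> if there is none. *)
definition first_time :: "(nat \<Rightarrow> bool) \<Rightarrow> enat" where
  "first_time P = (INF n\<in>{n. 1 \<le> n \<and> P n}. enat n)"

end

theory Submission
  imports Defs
begin

text \<open>
  If \<open>P\<close> has \<open>\<Sigma>\<close>-orthonormal columns, then \<open>P\<^sup>T \<Sigma> P = 1\<close> and \<open>\<Sigma>\<close> has inverse \<open>P P\<^sup>T\<close>, so the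
  confidence region is a translate of the image of a ball under \<open>\<Sigma> P\<close>, whose determinant is
  \<open>sqrt (det \<Sigma>)\<close> up to sign. This gives the volume of the region; dividing the stopping
  inequality by \<open>\<epsilon> s / sqrt n\<close>, where \<open>s\<close> is the \<open>2p\<close>-th root of \<open>det \<Sigma>\<close>, and squaring gives the
  bound on the effective sample size. Before \<open>n\<^sup>*\<close> the penalty term cancels the right-hand side and
  the positive term \<open>1 / n\<close> forbids stopping.
\<close>

section \<open>Linear images of measurable sets\<close>

lemma det_matrix_shear:
  fixes m n :: "'n::finite"
  assumes "m \<noteq> n"
  shows "det (matrix (\<lambda>v::real^'n. \<chi> i. if i = m then v $ m + v $ n else v $ i)) = 1"
proof -
  have "matrix (\<lambda>v::real^'n. \<chi> i. if i = m then v $ m + v $ n else v $ i) =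
      (\<chi> k. if k = m then row m (mat 1) + 1 *s row n (mat 1) else row k (mat 1))"
    by (auto simp: vec_eq_iff matrix_def row_def mat_def axis_def)
  then show ?thesis
    using det_row_operation[OF assms, of "mat 1 :: real^'n^'n" 1] by simp
qed

text \<open>\<open>measure_shear_interval\<close> asks for a box whose lower corner has a
  nonnegative \<open>n\<close>-th coordinate. By linearity, translating a box only translates its
  image, so any box can be moved there first.\<close>

lemma measure_shear_cbox:
  fixes a b :: "real^'n"
  assumes "m \<noteq> n"
  defines "h \<equiv> (\<lambda>v::real^'n. \<chi> i. if i = m then v $ m + v $ n else v $ i)"
  shows "measure lebesgue (h ` cbox a b) = measure lebesgue (cbox a b)"
proof (cases "cbox a b = {}")
  case False
  \<comment> \<open>Translation by \<open>v\<close> makes coordinate \<open>n\<close> of the lower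
    corner 0.\<close>
  define v :: "real^'n" where "v = - axis n (a $ n)"
  have "linear h"
    unfolding h_def by (rule linearI) (auto simp: algebra_simps vec_eq_iff)
  then have "h x = - h v + h (v + x)" for x
    by (simp add: linear_add)
  then have "h ` cbox a b = (+) (- h v) ` h ` (+) v ` cbox a b"
    unfolding image_image by (rule image_cong[OF refl])
  then have "measure lebesgue (h ` cbox a b) = measure lebesgue (h ` (+) v ` cbox a b)"
    by (metis measure_translation)
  also have "\<dots> = measure lebesgue (h ` cbox (v + a) (v + b))"
    by (simp add: cbox_translation)
  also have "\<dots> = measure lebesgue (cbox (v + a) (v + b))"
    unfolding h_def
  proof (rule measure_shear_interval[OF assms(1)])
    show "cbox (v + a) (v + b) \<noteq> {}"
      using False by (metis cbox_translation image_is_empty)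
  qed (simp add: v_def)
  also have "\<dots> = measure lebesgue (cbox a b)"
    by (metis cbox_translation measure_translation)
  finally show ?thesis .
qed auto

text \<open>The map is an involution, so its determinant squares to 1; the absolute value covers
  both \<open>m = n\<close> and a genuine swap.\<close>

lemma abs_det_matrix_swap:
  fixes m n :: "'n::finite"
  shows "\<bar>det (matrix (\<lambda>v::real^'n. \<chi> i. v $ Transposition.transpose m n i))\<bar> = 1"
proof -
  define h where "h = (\<lambda>v::real^'n. \<chi> i. v $ Transposition.transpose m n i)"
  have "linear h"
    unfolding h_def by (rule linearI) (auto simp: vec_eq_iff)
  moreover have "h \<circ> h = id"
    by (auto simp: h_def vec_eq_iff)
  ultimately have "det (matrix h) * det (matrix h) = 1"
    by (metis det_I det_mul matrix_compose matrix_id_mat_1)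
  then show ?thesis
    unfolding h_def by (metis abs_square_eq_1 power2_eq_square)
qed

lemma measure_swap_cbox:
  fixes a b :: "real^'n" and m n :: 'n
  defines "h \<equiv> (\<lambda>v::real^'n. \<chi> i. v $ Transposition.transpose m n i)"
  shows "measure lebesgue (h ` cbox a b) = measure lebesgue (cbox a b)"
proof (cases "cbox a b = {}")
  case False
  have inv: "h (h x) = x" for x
    by (simp add: h_def vec_eq_iff)
  have sub: "h ` cbox c d \<subseteq> cbox (h c) (h d)" for c d
    by (auto simp: h_def mem_box_cart)
  have eq: "h ` cbox a b = cbox (h a) (h b)"
  proof
    \<comment> \<open>As \<open>h\<close> is its own inverse, this is the forward inclusion for the
      corners \<open>h a\<close> and \<open>h b\<close>.\<close>
    show "cbox (h a) (h b) \<subseteq> h ` cbox a b"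
    proof
      fix x assume "x \<in> cbox (h a) (h b)"
      then have "h x \<in> cbox a b"
        using sub[of "h a" "h b"] by (auto simp: inv)
      then show "x \<in> h ` cbox a b"
        by (metis imageI inv)
    qed
  qed (rule sub)
  have "(\<Prod>i\<in>UNIV. h b $ i - h a $ i) = (\<Prod>i\<in>UNIV. b $ i - a $ i)"
    unfolding h_def vec_lambda_beta
    by (rule prod.reindex_bij_betw[where h = "Transposition.transpose m n"
          and g = "\<lambda>i. b $ i - a $ i"]) simp
  moreover have "cbox (h a) (h b) \<noteq> {}"
    using False eq by blast
  ultimately show ?thesis
    using False by (simp add: eq content_cbox_cart)
qed auto

text \<open>The library has this only for index types of class \<open>wellorder\<close>.\<close>
lemma
  fixes f :: "real^'n \<Rightarrow> real^'n"
  assumes "linear f" "S \<in> lmeasurable"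
  shows lmeasurable_linear_image: "f ` S \<in> lmeasurable"
    and measure_linear_image_det: "measure lebesgue (f ` S) = \<bar>det (matrix f)\<bar> * measure lebesgue S"
proof -
  \<comment> \<open>Measurability belongs to the predicate because the composition case applies the
    formula for \<open>f\<close> to the image of a set under \<open>g\<close>.\<close>
  define P where "P = (\<lambda>f::real^'n \<Rightarrow> real^'n. \<forall>S\<in>lmeasurable. f ` S \<in> lmeasurable \<and>
    measure lebesgue (f ` S) = \<bar>det (matrix f)\<bar> * measure lebesgue S)"
  \<comment> \<open>Serves swaps and shears: \<open>measure_linear_sufficient\<close> carries volume
    preservation from boxes to all sets of finite measure.\<close>
  have unimodular: "P h" if "linear h" "\<bar>det (matrix h)\<bar> = 1"
    "\<And>a b. measure lebesgue (h ` cbox a b) = measure lebesgue (cbox a b)" for h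
    unfolding P_def that(2)
  proof
    fix S :: "(real^'n) set"
    assume "S \<in> lmeasurable"
    then have "h ` S \<in> lmeasurable \<and> 1 * measure lebesgue S = measure lebesgue (h ` S)"
      by (rule measure_linear_sufficient[OF that(1)]) (simp only: that(3) mult_1)
    then show "h ` S \<in> lmeasurable \<and> measure lebesgue (h ` S) = 1 * measure lebesgue S"
      by simp
  qed
  have "P f"
  proof (rule induct_linear_elementary[OF assms(1)])
    fix f g :: "real^'n \<Rightarrow> real^'n"
    assume fg: "linear f" "linear g" "P f" "P g"
    then show "P (f \<circ> g)"
      unfolding P_def image_comp[symmetric] matrix_compose[OF fg(2,1)] det_mul
      by (simp add: abs_mult)
  next
    fix f :: "real^'n \<Rightarrow> real^'n" and i
    assume f: "linear f" "\<And>x. f x $ i = 0"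
    \<comment> \<open>A map with a vanishing coordinate is singular: its determinant is 0 and its
      images are negligible, so both sides vanish.\<close>
    have "\<not> surj f"
      by (metis f(2) one_neq_zero surjD vec_component)
    then have "\<not> inj f"
      using f(1) linear_injective_imp_surjective by blast
    then show "P f"
      using f(1) det_nz_iff_inj[OF f(1)] negligible_linear_singular_image[OF f(1)]
      by (simp add: P_def negligible_imp_measure0 negligible_imp_measurable)
  next
    fix c :: "'n \<Rightarrow> real"
    have "matrix (\<lambda>x::real^'n. \<chi> i. c i * x $ i) = (\<chi> i j. if i = j then c i else 0)"
      by (auto simp: matrix_def axis_def vec_eq_iff)
    then show "P (\<lambda>x. \<chi> i. c i * x $ i)"
      by (simp add: P_def measurable_stretch measure_stretch det_diagonal)
  next
    fix m n :: 'n
    show "P (\<lambda>x. \<chi> i. x $ Transposition.transpose m n i)"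
      by (rule unimodular[OF _ abs_det_matrix_swap measure_swap_cbox])
         (rule linearI, auto simp: vec_eq_iff)
  next
    fix m n :: 'n
    assume mn: "m \<noteq> n"
    show "P (\<lambda>x. \<chi> i. if i = m then x $ m + x $ n else x $ i)"
      by (rule unimodular[OF _ _ measure_shear_cbox[OF mn]])
         (simp_all add: det_matrix_shear[OF mn] linear_iff vec_eq_iff algebra_simps)
  qed
  with assms(2) show "f ` S \<in> lmeasurable"
    and "measure lebesgue (f ` S) = \<bar>det (matrix f)\<bar> * measure lebesgue S"
    by (auto simp: P_def)
qed

section \<open>Positive definite matrices and ellipsoids\<close>

lemma inner_matrix_vector_mult_commute:
  fixes A :: "real^'n^'n"
  assumes "transpose A = A"
  shows "x \<bullet> (A *v y) = y \<bullet> (A *v x)"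
  by (metis assms dot_lmul_matrix inner_commute transpose_matrix_vector)

text \<open>Translates \<open>transpose P ** A ** P = mat 1\<close> into orthonormality of the
  columns of \<open>P\<close> for the form of \<open>A\<close>.\<close>

lemma transpose_mult_mult_nth:
  fixes A P :: "real^'n^'n"
  shows "(transpose P ** A ** P) $ i $ j = column i P \<bullet> (A *v column j P)"
  unfolding matrix_mul_assoc[symmetric]
  by (simp add: matrix_matrix_mult_def matrix_vector_mult_def inner_vec_def transpose_def
      column_def)

definition form_orthonormal :: "real^'n^'n \<Rightarrow> (real^'n) set \<Rightarrow> bool" where
  "form_orthonormal A B \<longleftrightarrow> finite B \<and> (\<forall>x\<in>B. \<forall>y\<in>B. x \<bullet> (A *v y) = of_bool (x = y))"

text \<open>Pairing with \<open>x\<close> kills all other terms. This yields linear independence and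
  also the projection coefficients for Gram-Schmidt.\<close>

lemma form_orthonormal_coefficient:
  assumes "form_orthonormal A B" "x \<in> B"
  shows "x \<bullet> (A *v (\<Sum>y\<in>B. c y *\<^sub>R y)) = c x"
proof -
  have "x \<bullet> (A *v (\<Sum>y\<in>B. c y *\<^sub>R y)) = (\<Sum>y\<in>B. c y * (x \<bullet> (A *v y)))"
    by (simp add: linear_sum[OF matrix_vector_mul_linear] inner_sum_right
        matrix_vector_mult_scaleR)
  also have "\<dots> = (\<Sum>y\<in>B. if x = y then c y else 0)"
    using assms by (intro sum.cong) (auto simp: form_orthonormal_def)
  finally show ?thesis
    using assms by (simp add: form_orthonormal_def)
qed

lemma form_orthonormal_independent:
  assumes "form_orthonormal A B"
  shows "independent B"
proof (rule independent_if_scalars_zero)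
  fix c x
  assume "(\<Sum>y\<in>B. c y *\<^sub>R y) = 0" "x \<in> B"
  then show "c x = 0"
    using form_orthonormal_coefficient[OF assms, of x c] by simp
qed (use assms in \<open>simp add: form_orthonormal_def\<close>)

text \<open>One Gram-Schmidt step: a vector outside the span loses its projection onto
  \<open>B\<close>, stays nonzero, and is normalised with respect to the form.\<close>

lemma form_orthonormal_extend:
  fixes A :: "real^'n^'n"
  assumes A: "positive_definite A" and B: "form_orthonormal A B" and "span B \<noteq> UNIV"
  obtains w where "w \<notin> B" "form_orthonormal A (insert w B)"
proof -
  obtain v where v: "v \<notin> span B"
    using assms(3) by blast
  define u where "u = v - (\<Sum>b\<in>B. (b \<bullet> (A *v v)) *\<^sub>R b)"
  have "(\<Sum>b\<in>B. (b \<bullet> (A *v v)) *\<^sub>R b) \<in> span B"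
    by (intro span_sum span_scale span_base)
  then have "u \<noteq> 0"
    using v unfolding u_def by auto
  then have pos: "u \<bullet> (A *v u) > 0"
    using A by (simp add: positive_definite_def)
  define w where "w = (1 / sqrt (u \<bullet> (A *v u))) *\<^sub>R u"
  have orth: "b \<bullet> (A *v w) = 0" if "b \<in> B" for b
    using form_orthonormal_coefficient[OF B that]
    by (simp add: w_def u_def matrix_vector_mult_scaleR matrix_vector_mult_diff_distrib
        inner_diff_right)
  then have orth': "w \<bullet> (A *v b) = 0" if "b \<in> B" for b
    using that A inner_matrix_vector_mult_commute by (metis positive_definite_def)
  have unit: "w \<bullet> (A *v w) = 1"
    using pos by (simp add: w_def matrix_vector_mult_scaleR field_simps)
  show thesis
  proof
    show "w \<notin> B"
      using orth unit by auto
    then show "form_orthonormal A (insert w B)"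
      using B orth orth' unit by (auto simp: form_orthonormal_def)
  qed
qed

text \<open>An orthonormal system of greatest size must span, since otherwise it could be extended;
  its members are the columns of \<open>P\<close>.\<close>

lemma positive_definite_congruent_mat_1:
  fixes A :: "real^'n^'n"
  assumes "positive_definite A"
  obtains P :: "real^'n^'n" where "transpose P ** A ** P = mat 1"
proof -
  \<comment> \<open>Independence bounds the size by the dimension, so a greatest size exists; the
    empty system starts the search.\<close>
  have bound: "card B \<le> CARD('n)" if "form_orthonormal A B" for B
    using independent_bound[OF form_orthonormal_independent[OF that]] by simp
  have "form_orthonormal A {}"
    by (simp add: form_orthonormal_def)
  moreover have "\<forall>B. form_orthonormal A B \<longrightarrow> card B < Suc CARD('n)"
    using bound by (simp add: less_Suc_eq_le)
  ultimately obtain B where B: "form_orthonormal A B"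
    and max: "\<And>C. form_orthonormal A C \<Longrightarrow> card C \<le> card B"
    using ex_has_greatest_nat[of "form_orthonormal A" "{}" card] by blast
  have fin: "finite B"
    using B by (simp add: form_orthonormal_def)
  have "span B = UNIV"
  proof (rule ccontr)
    assume "span B \<noteq> UNIV"
    then obtain w where "w \<notin> B" "form_orthonormal A (insert w B)"
      using form_orthonormal_extend[OF assms B] by blast
    then show False
      using max fin by fastforce
  qed
  then have "card B = CARD('n)"
    using dim_span_eq_card_independent[OF form_orthonormal_independent[OF B]] by simp
  then obtain f where f: "bij_betw f (UNIV::'n set) B"
    using fin finite_same_card_bij[of "UNIV::'n set" B] by auto
  define P :: "real^'n^'n" where "P = (\<chi> i j. f j $ i)"
  have col: "column j P = f j" for j
    by (simp add: P_def column_def vec_eq_iff)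
  have "f i \<bullet> (A *v f j) = of_bool (i = j)" for i j
    using B f by (auto simp: form_orthonormal_def bij_betw_def inj_eq)
  then have "transpose P ** A ** P = mat 1"
    by (simp add: vec_eq_iff transpose_mult_mult_nth col mat_def)
  then show thesis ..
qed

lemma positive_definite_det_pos:
  fixes A :: "real^'n^'n"
  assumes "positive_definite A"
  shows "det A > 0"
proof -
  obtain P :: "real^'n^'n" where "transpose P ** A ** P = mat 1"
    by (rule positive_definite_congruent_mat_1[OF assms])
  then have "det (transpose P ** A ** P) = 1"
    by simp
  then have "(det P)\<^sup>2 * det A = 1"
    by (simp add: det_mul det_transpose power2_eq_square mult_ac)
  then have "0 < (det P)\<^sup>2 * det A"
    by simp
  then show ?thesis
    by (simp add: zero_less_mult_iff)
qed

text \<open>\<open>matrix_inv\<close> chooses a two-sided inverse, and for square matrices over a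
  field a one-sided inverse is two-sided and unique.\<close>

lemma matrix_inv_eqI:
  fixes A B :: "'a::field^'n^'n"
  assumes "A ** B = mat 1"
  shows "matrix_inv A = B"
proof -
  have "B ** A = mat 1"
    using assms by (simp add: matrix_left_right_inverse)
  with assms have "matrix_inv A ** A = mat 1"
    unfolding matrix_inv_def by (rule someI2[where a = B, OF conjI]) simp
  then show ?thesis
    by (metis assms matrix_mul_assoc matrix_mul_lid matrix_mul_rid)
qed

lemma measure_ellipsoid:
  fixes A :: "real^'n^'n" and m :: "real^'n"
  assumes A: "positive_definite A" and r: "0 \<le> r"
  shows "measure lebesgue {x. (m - x) \<bullet> (matrix_inv A *v (m - x)) < r\<^sup>2} =
    unit_ball_vol (real CARD('n)) * r ^ CARD('n) * sqrt (det A)"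
proof -
  obtain P :: "real^'n^'n" where P: "transpose P ** A ** P = mat 1"
    by (rule positive_definite_congruent_mat_1[OF A])
  define Q where "Q = A ** P"
  have PQ: "transpose P ** Q = mat 1"
    using P by (simp add: Q_def matrix_mul_assoc)
  then have QP: "Q ** transpose P = mat 1"
    by (simp add: matrix_left_right_inverse)
  then have "A ** (P ** transpose P) = mat 1"
    by (simp add: Q_def matrix_mul_assoc)
  then have inv: "matrix_inv A = P ** transpose P"
    by (rule matrix_inv_eqI)
  \<comment> \<open>In the coordinates \<open>transpose P *v y\<close> the ellipsoid becomes a
    Euclidean ball; \<open>Q\<close> maps back.\<close>
  have form: "y \<bullet> (matrix_inv A *v y) = (norm (transpose P *v y))\<^sup>2" for y
    unfolding inv by (simp add: matrix_vector_mul_assoc[symmetric] dot_lmul_matrix[symmetric]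
        power2_norm_eq_inner)
  have "{x. (m - x) \<bullet> (matrix_inv A *v (m - x)) < r\<^sup>2} = (+) m ` (*v) Q ` ball 0 r"
  proof (intro set_eqI iffI)
    fix x
    assume "x \<in> {x. (m - x) \<bullet> (matrix_inv A *v (m - x)) < r\<^sup>2}"
    then have "norm (transpose P *v (m - x)) < r"
      using r by (simp add: form power_less_imp_less_base)
    then have "transpose P *v (x - m) \<in> ball 0 r"
      by (metis dist_0_norm matrix_vector_mult_diff_distrib mem_ball norm_minus_commute)
    moreover have "x = m + Q *v (transpose P *v (x - m))"
      by (simp add: matrix_vector_mul_assoc QP del: transpose_matrix_vector)
    ultimately show "x \<in> (+) m ` (*v) Q ` ball 0 r"
      by blast
  next
    fix x
    assume "x \<in> (+) m ` (*v) Q ` ball 0 r"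
    then obtain z where z: "norm z < r" "x = m + Q *v z"
      by auto
    then have "transpose P *v (x - m) = z"
      by (simp add: matrix_vector_mul_assoc PQ del: transpose_matrix_vector)
    then have "norm (transpose P *v (m - x)) = norm z"
      by (metis matrix_vector_mult_diff_distrib norm_minus_commute)
    then show "x \<in> {x. (m - x) \<bullet> (matrix_inv A *v (m - x)) < r\<^sup>2}"
      using z by (simp add: form power_strict_mono del: transpose_matrix_vector)
  qed
  then have "measure lebesgue {x. (m - x) \<bullet> (matrix_inv A *v (m - x)) < r\<^sup>2} =
      measure lebesgue ((*v) Q ` ball 0 r)"
    by (metis measure_translation)
  also have "\<dots> = \<bar>det Q\<bar> * (unit_ball_vol (real CARD('n)) * r ^ CARD('n))"
    using r by (simp add: measure_linear_image_det content_ball)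
  also have "\<bar>det Q\<bar> = sqrt (det A)"
  proof -
    \<comment> \<open>Combine \<open>det P * det Q = 1\<close> with
      \<open>det Q = det A * det P\<close>: multiplying the latter by \<open>det Q\<close> gives
      \<open>det A\<close>.\<close>
    have "det (transpose P ** Q) = 1"
      by (simp add: PQ)
    then have "det P * det Q = 1"
      by (simp add: det_mul det_transpose)
    then have "(det Q)\<^sup>2 = det A"
      by (metis Q_def det_mul mult.assoc mult.commute mult.right_neutral power2_eq_square)
    then show ?thesis
      by (metis real_sqrt_abs)
  qed
  finally show ?thesis
    by (simp add: mult_ac)
qed

text \<open>The functional equation of Gamma converts the usual constant, with
  \<open>Gamma (x / 2 + 1)\<close>, to the form used in the bound.\<close>

lemma unit_ball_vol_Gamma_half:
  assumes "x > 0"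
  shows "unit_ball_vol x = 2 * pi powr (x / 2) / (x * Gamma (x / 2))"
proof -
  have "Gamma (x / 2 + 1) = x / 2 * Gamma (x / 2)"
    using assms by (intro Gamma_plus1) (auto elim!: nonpos_Ints_cases)
  then show ?thesis
    unfolding unit_ball_vol_def by (simp only:) simp
qed

section \<open>The stopping rule\<close>

lemma region_volume_eq:
  fixes Y :: "nat \<Rightarrow> real^'p" and S :: "nat \<Rightarrow> real^'p^'p"
  assumes "1 \<le> n" and T: "0 < hotelling_quantile TYPE('p) (q n) (1 - \<alpha>)"
    and "positive_definite (S n)"
  shows "region_volume Y S q \<alpha> n =
    2 * pi powr (real CARD('p) / 2) / (real CARD('p) * Gamma (real CARD('p) / 2)) *
    sqrt (hotelling_quantile TYPE('p) (q n) (1 - \<alpha>) / real n) ^ CARD('p) * sqrt (det (S n))"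
proof -
  let ?T = "hotelling_quantile TYPE('p) (q n) (1 - \<alpha>)"
  \<comment> \<open>Dividing by the positive \<open>n\<close> exhibits an ellipsoid of radius
    \<open>sqrt (?T / real n)\<close>.\<close>
  have "confidence_region Y S q \<alpha> n =
      {\<theta>. (sample_mean Y n - \<theta>) \<bullet> (matrix_inv (S n) *v (sample_mean Y n - \<theta>)) < (sqrt (?T / real n))\<^sup>2}"
    using assms by (simp add: confidence_region_def field_simps)
  then show ?thesis
    using measure_ellipsoid[OF assms(3), of "sqrt (?T / real n)"] T
    by (simp add: region_volume_def unit_ball_vol_Gamma_half)
qed

lemma region_volume_powr:
  fixes Y :: "nat \<Rightarrow> real^'p" and S :: "nat \<Rightarrow> real^'p^'p"
  assumes "1 \<le> n" and T: "0 < hotelling_quantile TYPE('p) (q n) (1 - \<alpha>)"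
    and S: "positive_definite (S n)"
  shows "region_volume Y S q \<alpha> n powr (1 / real CARD('p)) =
    (2 * pi powr (real CARD('p) / 2) / (real CARD('p) * Gamma (real CARD('p) / 2)))
      powr (1 / real CARD('p)) *
    sqrt (hotelling_quantile TYPE('p) (q n) (1 - \<alpha>)) / sqrt (real n) *
    det (S n) powr (1 / (2 * real CARD('p)))"
proof -
  let ?T = "hotelling_quantile TYPE('p) (q n) (1 - \<alpha>)"
  have pos: "sqrt (?T / real n) > 0" "det (S n) > 0"
    using assms positive_definite_det_pos[OF S] by auto
  have "(sqrt (?T / real n) ^ CARD('p)) powr (1 / real CARD('p)) = sqrt (?T / real n)"
    using pos by (simp add: powr_powr flip: powr_realpow)
  moreover have "sqrt (det (S n)) powr (1 / real CARD('p)) = det (S n) powr (1 / (2 * real CARD('p)))"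
    using pos by (simp add: powr_half_sqrt[symmetric] powr_powr)
  \<comment> \<open>With the constant kept abstract as \<open>c\<close>, the root distributes over
    three nonnegative factors.\<close>
  ultimately have root: "(c * sqrt (?T / real n) ^ CARD('p) * sqrt (det (S n))) powr (1 / real CARD('p)) =
      c powr (1 / real CARD('p)) * sqrt (?T / real n) * det (S n) powr (1 / (2 * real CARD('p)))"
    if "0 \<le> c" for c
    using that pos by (simp add: powr_mult del: real_sqrt_divide)
  show ?thesis
    unfolding region_volume_eq[where Y = Y and S = S and q = q and n = n, OF assms]
    by (subst root) (simp_all add: Gamma_real_pos less_imp_le real_sqrt_divide)
qed

lemma stopping_inequality_iff_ess:
  fixes Y :: "nat \<Rightarrow> real^'p" and S :: "nat \<Rightarrow> real^'p^'p"
  assumes "1 \<le> n" "nstar \<le> n" "0 < \<epsilon>"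
    and T: "0 < hotelling_quantile TYPE('p) (q n) (1 - \<alpha>)"
    and L: "positive_definite (sample_cov Y n)" and S: "positive_definite (S n)"
  shows "stopping_inequality Y S q \<alpha> \<epsilon> nstar n \<longleftrightarrow> ess Y S n \<ge> ess_lower_bound S q \<alpha> \<epsilon> n"
proof -
  define p where "p = real CARD('p)"
  define K where "K = (2 * pi powr (p / 2) / (p * Gamma (p / 2))) powr (1 / p) *
    sqrt (hotelling_quantile TYPE('p) (q n) (1 - \<alpha>))"
  define l where "l = det (sample_cov Y n) powr (1 / (2 * p))"
  define s where "s = det (S n) powr (1 / (2 * p))"
  define N where "N = sqrt (real n)"
  have dets: "det (sample_cov Y n) > 0" "det (S n) > 0"
    using L S positive_definite_det_pos by auto
  then have pos: "l > 0" "s > 0" "N > 0"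
    using \<open>1 \<le> n\<close> by (auto simp: l_def s_def N_def)
  have "K \<ge> 0"
    using T by (simp add: K_def)
  have "(l / s)\<^sup>2 = (det (sample_cov Y n) / det (S n)) powr (1 / p)"
    using dets by (simp add: l_def s_def powr_divide power_divide power2_eq_square
        flip: powr_add)
  then have ess: "ess Y S n = (N * (l / s))\<^sup>2"
    unfolding power_mult_distrib by (simp add: ess_def p_def N_def)
  have bound: "ess_lower_bound S q \<alpha> \<epsilon> n = ((K + 1 / (s * N)) / \<epsilon>)\<^sup>2"
    unfolding ess_lower_bound_def K_def s_def N_def p_def powr_minus_divide
    by (simp add: power_divide)
  \<comment> \<open>Here \<open>nstar \<le> n\<close>, so the indicator is 0.\<close>
  have "stopping_inequality Y S q \<alpha> \<epsilon> nstar n \<longleftrightarrow> K / N * s + 1 / N\<^sup>2 \<le> \<epsilon> * l"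
    using assms unfolding stopping_inequality_def region_volume_powr[where Y = Y and S = S and q = q and n = n, OF assms(1) T S]
    by (simp add: K_def l_def s_def p_def N_def)
  \<comment> \<open>The common positive factor \<open>\<epsilon> * s / N\<close> is split off both
    sides, leaving exactly the square roots of the bound and of the effective sample size.\<close>
  also have "K / N * s + 1 / N\<^sup>2 = (K + 1 / (s * N)) / \<epsilon> * (\<epsilon> * s / N)"
    using pos \<open>0 < \<epsilon>\<close> by (simp add: field_simps power2_eq_square)
  also have "\<epsilon> * l = N * (l / s) * (\<epsilon> * s / N)"
    using pos by simp
  also have "(K + 1 / (s * N)) / \<epsilon> * (\<epsilon> * s / N) \<le> N * (l / s) * (\<epsilon> * s / N) \<longleftrightarrow>
      (K + 1 / (s * N)) / \<epsilon> \<le> N * (l / s)"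
    using pos \<open>0 < \<epsilon>\<close> by (intro mult_le_cancel_right_pos) simp
  \<comment> \<open>Both sides are nonnegative, the left one because \<open>K \<ge> 0\<close>, so
    squaring is an equivalence.\<close>
  also have "\<dots> \<longleftrightarrow> ess Y S n \<ge> ess_lower_bound S q \<alpha> \<epsilon> n"
    unfolding ess bound using pos \<open>0 < \<epsilon>\<close> \<open>K \<ge> 0\<close> by (intro power_mono_iff[symmetric]) auto
  finally show ?thesis .
qed

text \<open>What remains after cancellation is a \<open>powr\<close>, never negative over the reals,
  plus \<open>1 / real n\<close>. Its positivity rests on \<open>1 \<le> n\<close>, as division by 0
  gives 0.\<close>

lemma not_stopping_inequality_before:
  assumes "1 \<le> n" "n < nstar"
  shows "\<not> stopping_inequality Y S q \<alpha> \<epsilon> nstar n"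
proof -
  have "region_volume Y S q \<alpha> n powr c + 1 / real n > 0" for c
    using assms by (intro add_nonneg_pos) auto
  then show ?thesis
    using assms by (simp add: stopping_inequality_def not_le)
qed

theorem mainTheorem3:
  fixes Y :: "nat \<Rightarrow> real ^ 'p"
    and S :: "nat \<Rightarrow> real ^ 'p ^ 'p"
    and q :: "nat \<Rightarrow> nat"
    and \<alpha> \<epsilon> :: real
    and nstar :: nat
  assumes "0 < \<alpha>" and "\<alpha> < 1" and "0 < \<epsilon>" and "1 \<le> nstar"
    and "\<And>n. nstar \<le> n \<Longrightarrow> 0 < hotelling_quantile TYPE('p) (q n) (1 - \<alpha>)"
    and "\<And>n. nstar \<le> n \<Longrightarrow> positive_definite (sample_cov Y n)"
    and "\<And>n. nstar \<le> n \<Longrightarrow> positive_definite (S n)"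
  shows "(\<forall>n\<ge>nstar. stopping_inequality Y S q \<alpha> \<epsilon> nstar n \<longleftrightarrow>
                      ess Y S n \<ge> ess_lower_bound S q \<alpha> \<epsilon> n) \<and>
         first_time (stopping_inequality Y S q \<alpha> \<epsilon> nstar) =
         first_time (\<lambda>n. nstar \<le> n \<and> ess Y S n \<ge> ess_lower_bound S q \<alpha> \<epsilon> n)"
proof
  show iff: "\<forall>n\<ge>nstar. stopping_inequality Y S q \<alpha> \<epsilon> nstar n \<longleftrightarrow>
      ess Y S n \<ge> ess_lower_bound S q \<alpha> \<epsilon> n"
    using assms by (intro allI impI stopping_inequality_iff_ess) (auto intro: le_trans)
  \<comment> \<open>Sizes below \<open>nstar\<close> lie in neither set; from \<open>nstar\<close>
    on the equivalence applies. Equal sets have equal first times, including the infinite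
    one.\<close>
  have "{n. 1 \<le> n \<and> stopping_inequality Y S q \<alpha> \<epsilon> nstar n} =
      {n. 1 \<le> n \<and> nstar \<le> n \<and> ess Y S n \<ge> ess_lower_bound S q \<alpha> \<epsilon> n}"
    using iff not_stopping_inequality_before by (metis not_le)
  then show "first_time (stopping_inequality Y S q \<alpha> \<epsilon> nstar) =
      first_time (\<lambda>n. nstar \<le> n \<and> ess Y S n \<ge> ess_lower_bound S q \<alpha> \<epsilon> n)"
    by (simp add: first_time_def)
qed

end
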